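(* Let $G$ be a groupoid and $x$ an object in $G$. Then: (1) $\pi_1(G/x)$ is a discrete poset (i.e. $a\le b$ implies $a=b$); and (2) as a pointed set, $\pi_1(G/x)$ is isomorphic to the underlying pointed set of the group $\pi_1(G,x)=\mathrm{Hom}_G(x,x)$ (pointed with $\mathrm{id}_x$).
   Context: Composition is written in diagrammatic order: $f;g$ means first $f$, then $g$. Poset reflection: for a category $C$, $\|C\|$ is the poset whose elements are equivalence classes $\|x\|$ of objects $x$ of $C$, with $\|x\|=\|y\|$ iff there exist morphisms $x\to y$ and $y\to x$, and $\|x\|\le\|y\|$ iff there exists a morphism $x\to y$ in $C$. This is functorial in $C$. Zeroth homotopy poset: for an object $x$ of a category $C$, the functor $\mathrm{dom}\colon C/x\to C$ from the slice category induces an order-preserving map $\|\mathrm{dom}\|\colon \|C/x\|\to\|C\|$. The pointed poset $(\pi_0(C/x),[x])$ is the quotient of $\|C\|$ by this map, i.e. the pushout in the category of posets of $\|\mathrm{dom}\|$ along the unique map $\|C/x\|\to 1$ to the one-element poset, pointed with the image $[x]$ of the element of $1$. Explicitly, an element of $\pi_0(C/x)$ is either $[x]$, or $\|y\|$ for an object $y$ such that there is no morphism $y\to x$; the order is: $[x]\le[x]$; $[x]\le\|y\|$ iff there is a span $x\leftarrow z\to y$ in $C$; never $\|y\|\le[x]$; and $\|y\|\le\|z\|$ iff there is a morphism $y\to z$. Category of parallel arrows: $\mathrm{Par}(C/x)$ has as objects the pairs $(f_0,f_1\colon y\to x)$ of parallel morphisms with codomain $x$; a morphism $(f_0,f_1\colon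 y\to x)\to(g_0,g_1\colon z\to x)$ is a morphism $h\colon y\to z$ with $f_0=h;g_0$ and $f_1=h;g_1$. First homotopy poset: $(\pi_1(C/x),[x])$ is the pointed poset $\bigl(\pi_0(\mathrm{Par}(C/x)/(\mathrm{id}_x,\mathrm{id}_x)),[(\mathrm{id}_x,\mathrm{id}_x)]\bigr)$, i.e. the zeroth homotopy poset of the category $\mathrm{Par}(C/x)$ over its object $(\mathrm{id}_x,\mathrm{id}_x)$. *)

theory Defs
  imports "HOL-Algebra.Group" "HOL-Algebra.Order"
begin

section \<open>Categories and groupoids\<close>

record ('o, 'm) cat =
  Obj :: "'o set"
  Arr :: "'m set"
  Dom :: "'m \<Rightarrow> 'o"
  Cod :: "'m \<Rightarrow> 'o"
  Ident :: "'o \<Rightarrow> 'm"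
  Comp :: "'m \<Rightarrow> 'm \<Rightarrow> 'm"  (infixl \<open>\<Zcomp>\<index>\<close> 70)

text \<open>Composition is diagrammatic: \<open>f \<Zcomp> g\<close> is first \<open>f\<close>, then \<open>g\<close>.\<close>

definition Hom :: "('o, 'm) cat \<Rightarrow> 'o \<Rightarrow> 'o \<Rightarrow> 'm set" where
  "Hom C x y = {f \<in> Arr C. Dom C f = x \<and> Cod C f = y}"

locale category =
  fixes C :: "('o, 'm) cat" (structure)
  assumes Dom_closed [simp, intro]: "f \<in> Arr C \<Longrightarrow> Dom C f \<in> Obj C"
    and Cod_closed [simp, intro]: "f \<in> Arr C \<Longrightarrow> Cod C f \<in> Obj C"
    and Ident_Hom: "x \<in> Obj C \<Longrightarrow> Ident C x \<in> Hom C x x"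
    and Comp_Hom: "\<lbrakk>f \<in> Hom C x y; g \<in> Hom C y z\<rbrakk> \<Longrightarrow> f \<Zcomp> g \<in> Hom C x z"
    and Ident_left: "f \<in> Hom C x y \<Longrightarrow> Ident C x \<Zcomp> f = f"
    and Ident_right: "f \<in> Hom C x y \<Longrightarrow> f \<Zcomp> Ident C y = f"
    and Comp_assoc:
      "\<lbrakk>f \<in> Hom C w x; g \<in> Hom C x y; h \<in> Hom C y z\<rbrakk> \<Longrightarrow> (f \<Zcomp> g) \<Zcomp> h = f \<Zcomp> (g \<Zcomp> h)"

locale groupoid = category G for G :: "('o, 'm) cat" (structure) +
  assumes Inverse_ex:
    "f \<in> Hom G x y \<Longrightarrow> \<exists>g \<in> Hom G y x. f \<Zcomp> g = Ident G x \<and> g \<Zcomp> f = Ident G y"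

definition fundamental_group :: "('o, 'm) cat \<Rightarrow> 'o \<Rightarrow> 'm monoid" where
  "fundamental_group G x = \<lparr>carrier = Hom G x x, mult = Comp G, one = Ident G x\<rparr>"

lemma Hom_objs: "category C \<Longrightarrow> f \<in> Hom C x y \<Longrightarrow> x \<in> Obj C \<and> y \<in> Obj C"
  by (auto simp: Hom_def category.Dom_closed category.Cod_closed)

lemma (in groupoid) group_fundamental_group:
  assumes "x \<in> Obj G"
  shows "group (fundamental_group G x)"
proof (rule groupI)
  fix f assume "f \<in> carrier (fundamental_group G x)"
  then show "\<exists>g \<in> carrier (fundamental_group G x).
      g \<otimes>\<^bsub>fundamental_group G x\<^esub> f = \<one>\<^bsub>fundamental_group G x\<^esub>"
    using Inverse_ex[of f x x] by (auto simp: fundamental_group_def)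
qed (use assms in \<open>auto simp: fundamental_group_def
      intro: Comp_Hom Ident_Hom Comp_assoc Ident_left\<close>)


section \<open>Slice categories and parallel arrows\<close>

text \<open>An arrow records its source and target objects together with the underlying arrow of \<open>C\<close>,
  since one arrow \<open>h\<close> of \<open>C\<close> may underlie arrows between different objects.\<close>

definition slice :: "('o, 'm) cat \<Rightarrow> 'o \<Rightarrow> ('m, 'm \<times> 'm \<times> 'm) cat" where
  "slice C x =
    \<lparr>Obj = {f \<in> Arr C. Cod C f = x},
     Arr = {(f, h, g). f \<in> Arr C \<and> Cod C f = x \<and> g \<in> Arr C \<and> Cod C g = x \<and>
              h \<in> Hom C (Dom C f) (Dom C g) \<and> f = Comp C h g},
     Dom = (\<lambda>(f, h, g). f),
     Cod = (\<lambda>(f, h, g). g),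
     Ident = (\<lambda>f. (f, Ident C (Dom C f), f)),
     Comp = (\<lambda>(f, h, g) (f', h', g'). (f, Comp C h h', g'))\<rparr>"

definition par_obj :: "('o, 'm) cat \<Rightarrow> 'o \<Rightarrow> ('m \<times> 'm) set" where
  "par_obj C x = {(f0, f1). f0 \<in> Arr C \<and> f1 \<in> Arr C \<and> Dom C f0 = Dom C f1 \<and>
                            Cod C f0 = x \<and> Cod C f1 = x}"

definition Par :: "('o, 'm) cat \<Rightarrow> 'o \<Rightarrow> ('m \<times> 'm, ('m \<times> 'm) \<times> 'm \<times> ('m \<times> 'm)) cat" where
  "Par C x =
    \<lparr>Obj = par_obj C x,
     Arr = {(f, h, g). f \<in> par_obj C x \<and> g \<in> par_obj C x \<and>
              h \<in> Hom C (Dom C (fst f)) (Dom C (fst g)) \<and>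
              fst f = Comp C h (fst g) \<and> snd f = Comp C h (snd g)},
     Dom = (\<lambda>(f, h, g). f),
     Cod = (\<lambda>(f, h, g). g),
     Ident = (\<lambda>f. (f, Ident C (Dom C (fst f)), f)),
     Comp = (\<lambda>(f, h, g) (f', h', g'). (f, Comp C h h', g'))\<rparr>"

lemma Hom_slice:
  "Hom (slice C x) f g =
    {(f, h, g) | h. f \<in> Obj (slice C x) \<and> g \<in> Obj (slice C x) \<and>
       h \<in> Hom C (Dom C f) (Dom C g) \<and> f = h \<Zcomp>\<^bsub>C\<^esub> g}"
  by (auto simp: slice_def Hom_def)

lemma category_slice:
  assumes "category C"
  shows "category (slice C x)"
proof -
  interpret category C by fact
  have Arr: "f \<in> Hom C (Dom C f) (Cod C f)" if "f \<in> Arr C" for f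
    using that by (simp add: Hom_def)
  have Comp: "Comp (slice C x) (f, h, g) (f', h', g') = (f, h \<Zcomp>\<^bsub>C\<^esub> h', g')" for f h g f' h' g'
    by (simp add: slice_def)
  have Ident: "Ident (slice C x) f = (f, Ident C (Dom C f), f)" for f
    by (simp add: slice_def)
  show ?thesis
  proof
    fix F assume "F \<in> Arr (slice C x)"
    then show "Dom (slice C x) F \<in> Obj (slice C x)" "Cod (slice C x) F \<in> Obj (slice C x)"
      by (auto simp: slice_def)
  next
    fix f assume "f \<in> Obj (slice C x)"
    then show "Ident (slice C x) f \<in> Hom (slice C x) f f"
      unfolding Hom_slice Ident
      by (auto simp: slice_def Ident_Hom dest!: Arr simp: Ident_left dest: Hom_objs[OF assms])
  next
    fix F F' f g k assume "F \<in> Hom (slice C x) f g" "F' \<in> Hom (slice C x) g k"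
    then obtain h h' where F: "F = (f, h, g)" "F' = (g, h', k)"
      and objs: "f \<in> Obj (slice C x)" "k \<in> Obj (slice C x)"
      and h: "h \<in> Hom C (Dom C f) (Dom C g)" "h' \<in> Hom C (Dom C g) (Dom C k)"
      and eqs: "f = h \<Zcomp>\<^bsub>C\<^esub> g" "g = h' \<Zcomp>\<^bsub>C\<^esub> k"
      unfolding Hom_slice by blast
    have "k \<in> Hom C (Dom C k) (Cod C k)"
      using objs(2) by (simp add: slice_def Hom_def)
    then have "f = (h \<Zcomp>\<^bsub>C\<^esub> h') \<Zcomp>\<^bsub>C\<^esub> k"
      using Comp_assoc[OF h] eqs by simp
    then show "Comp (slice C x) F F' \<in> Hom (slice C x) f k"
      unfolding F Comp Hom_slice using objs Comp_Hom[OF h] by blast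
  next
    fix F f g assume "F \<in> Hom (slice C x) f g"
    then show "Comp (slice C x) (Ident (slice C x) f) F = F"
      "Comp (slice C x) F (Ident (slice C x) g) = F"
      unfolding Hom_slice by (auto simp: Comp Ident Ident_left Ident_right)
  next
    fix F F' F'' f g k l
    assume "F \<in> Hom (slice C x) f g" "F' \<in> Hom (slice C x) g k" "F'' \<in> Hom (slice C x) k l"
    then show "Comp (slice C x) (Comp (slice C x) F F') F'' = Comp (slice C x) F (Comp (slice C x) F' F'')"
      unfolding Hom_slice by (auto simp: Comp Comp_assoc)
  qed
qed

lemma Hom_Par:
  "Hom (Par C x) f g =
    {(f, h, g) | h. f \<in> Obj (Par C x) \<and> g \<in> Obj (Par C x) \<and>
       h \<in> Hom C (Dom C (fst f)) (Dom C (fst g)) \<and> fst f = h \<Zcomp>\<^bsub>C\<^esub> fst g \<and> snd f = h \<Zcomp>\<^bsub>C\<^esub> snd g}"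
  by (auto simp: Par_def Hom_def)

lemma category_Par:
  assumes "category C"
  shows "category (Par C x)"
proof -
  interpret category C by fact
  have Arr: "f \<in> Hom C (Dom C f) (Cod C f)" if "f \<in> Arr C" for f
    using that by (simp add: Hom_def)
  have Comp: "Comp (Par C x) (f, h, g) (f', h', g') = (f, h \<Zcomp>\<^bsub>C\<^esub> h', g')" for f h g f' h' g'
    by (simp add: Par_def)
  have Ident: "Ident (Par C x) f = (f, Ident C (Dom C (fst f)), f)" for f
    by (simp add: Par_def)
  show ?thesis
  proof
    fix F assume "F \<in> Arr (Par C x)"
    then show "Dom (Par C x) F \<in> Obj (Par C x)" "Cod (Par C x) F \<in> Obj (Par C x)"
      by (auto simp: Par_def)
  next
    fix f assume "f \<in> Obj (Par C x)"
    then show "Ident (Par C x) f \<in> Hom (Par C x) f f"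
      unfolding Hom_Par Ident
      by (auto simp: Par_def par_obj_def Ident_Hom dest!: Arr simp: Ident_left dest: Hom_objs[OF assms])
  next
    fix F F' f g k assume "F \<in> Hom (Par C x) f g" "F' \<in> Hom (Par C x) g k"
    then obtain h h' where F: "F = (f, h, g)" "F' = (g, h', k)"
      and objs: "f \<in> Obj (Par C x)" "k \<in> Obj (Par C x)"
      and h: "h \<in> Hom C (Dom C (fst f)) (Dom C (fst g))" "h' \<in> Hom C (Dom C (fst g)) (Dom C (fst k))"
      and eqs: "fst f = h \<Zcomp>\<^bsub>C\<^esub> fst g" "snd f = h \<Zcomp>\<^bsub>C\<^esub> snd g"
        "fst g = h' \<Zcomp>\<^bsub>C\<^esub> fst k" "snd g = h' \<Zcomp>\<^bsub>C\<^esub> snd k"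
      unfolding Hom_Par by blast
    have "fst k \<in> Hom C (Dom C (fst k)) x" "snd k \<in> Hom C (Dom C (fst k)) x"
      using objs(2) by (auto simp: Par_def par_obj_def Hom_def)
    then have "fst f = (h \<Zcomp>\<^bsub>C\<^esub> h') \<Zcomp>\<^bsub>C\<^esub> fst k \<and> snd f = (h \<Zcomp>\<^bsub>C\<^esub> h') \<Zcomp>\<^bsub>C\<^esub> snd k"
      using Comp_assoc[OF h] eqs by simp
    then show "Comp (Par C x) F F' \<in> Hom (Par C x) f k"
      unfolding F Comp Hom_Par using objs Comp_Hom[OF h] by blast
  next
    fix F f g assume "F \<in> Hom (Par C x) f g"
    then show "Comp (Par C x) (Ident (Par C x) f) F = F"
      "Comp (Par C x) F (Ident (Par C x) g) = F"
      unfolding Hom_Par by (auto simp: Comp Ident Ident_left Ident_right)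
  next
    fix F F' F'' f g k l
    assume "F \<in> Hom (Par C x) f g" "F' \<in> Hom (Par C x) g k" "F'' \<in> Hom (Par C x) k l"
    then show "Comp (Par C x) (Comp (Par C x) F F') F'' = Comp (Par C x) F (Comp (Par C x) F' F'')"
      unfolding Hom_Par by (auto simp: Comp Comp_assoc)
  qed
qed


section \<open>Poset reflection\<close>

text \<open>Posets are structures satisfying \<^locale>\<open>partial_order\<close>, whose equivalence is equality.\<close>

definition preorder_quotient :: "'a set \<Rightarrow> 'a rel \<Rightarrow> 'a set gorder" where
  "preorder_quotient A r =
    \<lparr>carrier = A // (r \<inter> r\<inverse>), eq = (=), le = (\<lambda>X Y. \<exists>a\<in>X. \<exists>b\<in>Y. (a, b) \<in> r)\<rparr>"

definition hom_preorder :: "('o, 'm) cat \<Rightarrow> 'o rel" where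
  "hom_preorder C = {(x, y). x \<in> Obj C \<and> y \<in> Obj C \<and> Hom C x y \<noteq> {}}"

definition poset_reflection :: "('o, 'm) cat \<Rightarrow> 'o set gorder" where
  "poset_reflection C = preorder_quotient (Obj C) (hom_preorder C)"

definition refl_class :: "('o, 'm) cat \<Rightarrow> 'o \<Rightarrow> 'o set" where
  "refl_class C x = (hom_preorder C \<inter> (hom_preorder C)\<inverse>) `` {x}"

text \<open>The map of poset reflections induced by a functor into \<open>D\<close> with object part \<open>F\<close>; all the
  classes in the union coincide.\<close>

definition refl_map :: "('p, 'n) cat \<Rightarrow> ('o \<Rightarrow> 'p) \<Rightarrow> 'o set \<Rightarrow> 'p set" where
  "refl_map D F X = (\<Union>x\<in>X. refl_class D (F x))"

lemma equiv_preorder: "preorder_on A r \<Longrightarrow> equiv A (r \<inter> r\<inverse>)"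
  unfolding preorder_on_def
  by (intro equivI) (auto simp: refl_on_def sym_def intro!: transI elim: transE)

lemma preorder_quotient_le:
  assumes "preorder_on A r" "a \<in> A" "b \<in> A"
  shows "(r \<inter> r\<inverse>) `` {a} \<sqsubseteq>\<^bsub>preorder_quotient A r\<^esub> (r \<inter> r\<inverse>) `` {b} \<longleftrightarrow> (a, b) \<in> r"
  using assms unfolding preorder_on_def preorder_quotient_def
  by (auto simp: refl_on_def elim: transE) (meson transE)+

lemma partial_order_preorder_quotient:
  assumes "preorder_on A r"
  shows "partial_order (preorder_quotient A r)"
proof -
  let ?P = "preorder_quotient A r"
  note le = preorder_quotient_le[OF assms]
  have r: "refl_on A r" "trans r" using assms by (auto simp: preorder_on_def)
  have car: "\<exists>a\<in>A. X = (r \<inter> r\<inverse>) `` {a}" if "X \<in> carrier ?P" for X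
    using that by (auto simp: preorder_quotient_def quotient_def)
  have eq: "eq ?P = (=)" by (simp add: preorder_quotient_def)
  show ?thesis
  proof (unfold_locales; (unfold eq)?)
    show "X \<sqsubseteq>\<^bsub>?P\<^esub> X" if "X \<in> carrier ?P" for X
      using car[OF that] le r(1) by (auto simp: refl_on_def)
    show "X = Y" if "X \<sqsubseteq>\<^bsub>?P\<^esub> Y" "Y \<sqsubseteq>\<^bsub>?P\<^esub> X" "X \<in> carrier ?P" "Y \<in> carrier ?P" for X Y
      using car[OF that(3)] car[OF that(4)] that(1,2) le
      by (auto intro!: equiv_class_eq[OF equiv_preorder[OF assms]])
    show "X \<sqsubseteq>\<^bsub>?P\<^esub> Z" if "X \<sqsubseteq>\<^bsub>?P\<^esub> Y" "Y \<sqsubseteq>\<^bsub>?P\<^esub> Z" "X \<in> carrier ?P" "Y \<in> carrier ?P" "Z \<in> carrier ?P"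
      for X Y Z
      using car[OF that(3)] car[OF that(4)] car[OF that(5)] that(1,2) le r(2)
      by (auto elim: transE)
  qed auto
qed

lemma preorder_hom_preorder:
  assumes "category C"
  shows "preorder_on (Obj C) (hom_preorder C)"
proof -
  interpret category C by fact
  show ?thesis
    unfolding preorder_on_def hom_preorder_def
    using Ident_Hom Comp_Hom by (fastforce intro!: refl_onI transI)
qed

lemma partial_order_poset_reflection: "category C \<Longrightarrow> partial_order (poset_reflection C)"
  unfolding poset_reflection_def
  by (intro partial_order_preorder_quotient preorder_hom_preorder)


section \<open>Pushouts of posets\<close>

text \<open>The pushout of \<open>f: P \<rightarrow> Q\<close> and \<open>g: P \<rightarrow> R\<close> is the quotient of the disjoint union of
  \<open>Q\<close> and \<open>R\<close> by the least preorder that extends both orders and identifies \<open>f p\<close> with \<open>g p\<close>.\<close>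

definition pushout_step ::
    "'p gorder \<Rightarrow> 'q gorder \<Rightarrow> 'r gorder \<Rightarrow> ('p \<Rightarrow> 'q) \<Rightarrow> ('p \<Rightarrow> 'r) \<Rightarrow> ('q + 'r) rel" where
  "pushout_step P Q R f g =
    {(Inl a, Inl b) | a b. a \<in> carrier Q \<and> b \<in> carrier Q \<and> a \<sqsubseteq>\<^bsub>Q\<^esub> b} \<union>
    {(Inr a, Inr b) | a b. a \<in> carrier R \<and> b \<in> carrier R \<and> a \<sqsubseteq>\<^bsub>R\<^esub> b} \<union>
    {(Inl (f p), Inr (g p)) | p. p \<in> carrier P} \<union>
    {(Inr (g p), Inl (f p)) | p. p \<in> carrier P}"

definition pushout_preorder ::
    "'p gorder \<Rightarrow> 'q gorder \<Rightarrow> 'r gorder \<Rightarrow> ('p \<Rightarrow> 'q) \<Rightarrow> ('p \<Rightarrow> 'r) \<Rightarrow> ('q + 'r) rel" where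
  "pushout_preorder P Q R f g =
    (pushout_step P Q R f g)\<^sup>* \<inter> ((carrier Q <+> carrier R) \<times> (carrier Q <+> carrier R))"

definition poset_pushout ::
    "'p gorder \<Rightarrow> 'q gorder \<Rightarrow> 'r gorder \<Rightarrow> ('p \<Rightarrow> 'q) \<Rightarrow> ('p \<Rightarrow> 'r) \<Rightarrow> ('q + 'r) set gorder" where
  "poset_pushout P Q R f g =
    preorder_quotient (carrier Q <+> carrier R) (pushout_preorder P Q R f g)"

definition pushout_class ::
    "'p gorder \<Rightarrow> 'q gorder \<Rightarrow> 'r gorder \<Rightarrow> ('p \<Rightarrow> 'q) \<Rightarrow> ('p \<Rightarrow> 'r) \<Rightarrow> 'q + 'r \<Rightarrow> ('q + 'r) set" where
  "pushout_class P Q R f g s =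
    (pushout_preorder P Q R f g \<inter> (pushout_preorder P Q R f g)\<inverse>) `` {s}"

lemma preorder_pushout_preorder:
  "preorder_on (carrier Q <+> carrier R) (pushout_preorder P Q R f g)"
  unfolding preorder_on_def pushout_preorder_def
  by (auto intro!: refl_onI transI)

lemma partial_order_poset_pushout: "partial_order (poset_pushout P Q R f g)"
  unfolding poset_pushout_def
  by (intro partial_order_preorder_quotient preorder_pushout_preorder)

lemma pushout_class_le:
  "\<lbrakk>s \<in> carrier Q <+> carrier R; t \<in> carrier Q <+> carrier R\<rbrakk> \<Longrightarrow>
    pushout_class P Q R f g s \<sqsubseteq>\<^bsub>poset_pushout P Q R f g\<^esub> pushout_class P Q R f g t \<longleftrightarrow>
    (s, t) \<in> pushout_preorder P Q R f g"
  unfolding pushout_class_def poset_pushout_def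
  by (rule preorder_quotient_le[OF preorder_pushout_preorder])

lemma carrier_poset_pushout:
  "carrier (poset_pushout P Q R f g) = pushout_class P Q R f g ` (carrier Q <+> carrier R)"
  by (auto simp: poset_pushout_def preorder_quotient_def quotient_def pushout_class_def)

lemma pushout_step_isotone:
  assumes "partial_order T" "isotone Q T u" "isotone R T v"
    and "u ` carrier Q \<subseteq> carrier T" "v ` carrier R \<subseteq> carrier T"
    and "f ` carrier P \<subseteq> carrier Q" "g ` carrier P \<subseteq> carrier R"
    and "\<And>p. p \<in> carrier P \<Longrightarrow> u (f p) = v (g p)"
    and "(s, t) \<in> (pushout_step P Q R f g)\<^sup>*" "s \<in> carrier Q <+> carrier R"
  shows "t \<in> carrier Q <+> carrier R \<and> case_sum u v s \<sqsubseteq>\<^bsub>T\<^esub> case_sum u v t"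
  using assms(9)
proof (induction rule: rtrancl_induct)
  case base
  interpret T: partial_order T by fact
  show ?case using assms(4,5,10) by auto
next
  case (step y z)
  interpret T: partial_order T by fact
  have kA: "case_sum u v r \<in> carrier T" if "r \<in> carrier Q <+> carrier R" for r
    using that assms(4,5) by auto
  from step.hyps(2) consider
    (left) a b where "y = Inl a" "z = Inl b" "a \<in> carrier Q" "b \<in> carrier Q" "a \<sqsubseteq>\<^bsub>Q\<^esub> b"
    | (right) a b where "y = Inr a" "z = Inr b" "a \<in> carrier R" "b \<in> carrier R" "a \<sqsubseteq>\<^bsub>R\<^esub> b"
    | (into) p where "y = Inl (f p)" "z = Inr (g p)" "p \<in> carrier P"
    | (out) p where "y = Inr (g p)" "z = Inl (f p)" "p \<in> carrier P"
    unfolding pushout_step_def by blast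
  then have z: "z \<in> carrier Q <+> carrier R \<and> case_sum u v y \<sqsubseteq>\<^bsub>T\<^esub> case_sum u v z"
  proof cases
    case left
    then show ?thesis using assms(2) by (auto simp: isotone_def)
  next
    case right
    then show ?thesis using assms(3) by (auto simp: isotone_def)
  next
    case into
    then show ?thesis using assms(4-8) T.le_refl by (auto simp: image_subset_iff)
  next
    case out
    then show ?thesis using assms(4-8) T.le_refl by (auto simp: image_subset_iff)
  qed
  then show ?case
    using step.IH kA[OF assms(10)] kA[of y] kA[of z]
      T.le_trans[of "case_sum u v s" "case_sum u v y" "case_sum u v z"] by simp
qed

theorem poset_pushout_universal:
  assumes "partial_order P" "partial_order Q" "partial_order R"
    and f: "isotone P Q f" "f ` carrier P \<subseteq> carrier Q"
    and g: "isotone P R g" "g ` carrier P \<subseteq> carrier R"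
  defines "c \<equiv> pushout_class P Q R f g" and "W \<equiv> poset_pushout P Q R f g"
  shows "isotone Q W (c \<circ> Inl)" "isotone R W (c \<circ> Inr)"
    and "\<And>p. p \<in> carrier P \<Longrightarrow> c (Inl (f p)) = c (Inr (g p))"
    and "\<And>(T :: 't gorder) u v.
          \<lbrakk>partial_order T; isotone Q T u; u ` carrier Q \<subseteq> carrier T;
           isotone R T v; v ` carrier R \<subseteq> carrier T;
           \<And>p. p \<in> carrier P \<Longrightarrow> u (f p) = v (g p)\<rbrakk> \<Longrightarrow>
          \<exists>!w. w \<in> extensional (carrier W) \<and> isotone W T w \<and> w ` carrier W \<subseteq> carrier T \<and>
             (\<forall>a \<in> carrier Q. w (c (Inl a)) = u a) \<and> (\<forall>b \<in> carrier R. w (c (Inr b)) = v b)"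
proof -
  interpret Q: partial_order Q by fact
  interpret R: partial_order R by fact
  interpret W: partial_order W unfolding W_def by (rule partial_order_poset_pushout)
  let ?A = "carrier Q <+> carrier R"
  have leW: "c s \<sqsubseteq>\<^bsub>W\<^esub> c t \<longleftrightarrow> (s, t) \<in> (pushout_step P Q R f g)\<^sup>*" if "s \<in> ?A" "t \<in> ?A" for s t
    using pushout_class_le[OF that] that by (simp add: c_def W_def pushout_preorder_def)
  have stepW: "c s \<sqsubseteq>\<^bsub>W\<^esub> c t" if "(s, t) \<in> pushout_step P Q R f g" "s \<in> ?A" "t \<in> ?A" for s t
    using that leW by blast
  have carW: "carrier W = c ` ?A"
    unfolding c_def W_def by (rule carrier_poset_pushout)
  show "isotone Q W (c \<circ> Inl)"
    unfolding isotone_def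
    using Q.weak_partial_order_axioms W.weak_partial_order_axioms
    by (auto intro!: stepW simp: pushout_step_def)
  show "isotone R W (c \<circ> Inr)"
    unfolding isotone_def
    using R.weak_partial_order_axioms W.weak_partial_order_axioms
    by (auto intro!: stepW simp: pushout_step_def)
  show "c (Inl (f p)) = c (Inr (g p))" if p: "p \<in> carrier P" for p
  proof (rule W.le_antisym)
    have A: "Inl (f p) \<in> ?A" "Inr (g p) \<in> ?A" using p f(2) g(2) by auto
    show "c (Inl (f p)) \<sqsubseteq>\<^bsub>W\<^esub> c (Inr (g p))" "c (Inr (g p)) \<sqsubseteq>\<^bsub>W\<^esub> c (Inl (f p))"
      using p A by (auto intro!: stepW simp: pushout_step_def)
    show "c (Inl (f p)) \<in> carrier W" "c (Inr (g p)) \<in> carrier W"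
      unfolding carW using A by (blast intro: imageI)+
  qed
  fix T :: "'t gorder" and u v
  assume T: "partial_order T" and u: "isotone Q T u" "u ` carrier Q \<subseteq> carrier T"
    and v: "isotone R T v" "v ` carrier R \<subseteq> carrier T"
    and uv: "\<And>p. p \<in> carrier P \<Longrightarrow> u (f p) = v (g p)"
  interpret T: partial_order T by fact
  let ?k = "case_sum u v"
  have kA: "?k s \<in> carrier T" if "s \<in> ?A" for s using that u(2) v(2) by auto
  have mono: "?k s \<sqsubseteq>\<^bsub>T\<^esub> ?k t" if "s \<in> ?A" "t \<in> ?A" "c s \<sqsubseteq>\<^bsub>W\<^esub> c t" for s t
    using pushout_step_isotone[OF T u(1) v(1) u(2) v(2) f(2) g(2) uv] that leW by blast
  define w where "w = restrict (\<lambda>X. ?k (SOME s. s \<in> ?A \<and> X = c s)) (carrier W)"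
  have w: "w (c s) = ?k s" if s: "s \<in> ?A" for s
  proof -
    define t where "t = (SOME t. t \<in> ?A \<and> c s = c t)"
    have t: "t \<in> ?A \<and> c s = c t" unfolding t_def by (rule someI[of _ s]) (use s in blast)
    have "c s \<in> carrier W" using s carW by blast
    then have "w (c s) = ?k t" and r: "c s \<sqsubseteq>\<^bsub>W\<^esub> c s"
      by (simp_all add: w_def t_def)
    moreover have "?k t = ?k s"
      using mono[of s t] mono[of t s] t s r kA by (metis T.le_antisym)
    ultimately show ?thesis by simp
  qed
  show "\<exists>!w. w \<in> extensional (carrier W) \<and> isotone W T w \<and> w ` carrier W \<subseteq> carrier T \<and>
      (\<forall>a \<in> carrier Q. w (c (Inl a)) = u a) \<and> (\<forall>b \<in> carrier R. w (c (Inr b)) = v b)"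
  proof (rule ex1I[of _ w], intro conjI)
    show "w \<in> extensional (carrier W)" by (simp add: w_def)
    show "isotone W T w"
      unfolding isotone_def carW
      using W.weak_partial_order_axioms T.weak_partial_order_axioms mono w by auto
    show "w ` carrier W \<subseteq> carrier T" unfolding carW image_image by (simp add: w kA image_subset_iff)
    show "\<forall>a \<in> carrier Q. w (c (Inl a)) = u a" "\<forall>b \<in> carrier R. w (c (Inr b)) = v b"
      using w[OF InlI] w[OF InrI] by auto
  next
    fix w' assume w': "w' \<in> extensional (carrier W) \<and> isotone W T w' \<and> w' ` carrier W \<subseteq> carrier T \<and>
      (\<forall>a \<in> carrier Q. w' (c (Inl a)) = u a) \<and> (\<forall>b \<in> carrier R. w' (c (Inr b)) = v b)"
    show "w' = w"
    proof (rule extensionalityI[of _ "carrier W"])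
      fix X assume "X \<in> carrier W"
      then obtain s where "s \<in> ?A" "X = c s" using carW by blast
      then show "w' X = w X" using w' w by auto
    qed (use w' in \<open>auto simp: w_def\<close>)
  qed
qed


section \<open>Homotopy posets\<close>

record 'a pointed_gorder = "'a gorder" +
  point :: 'a

definition unit_poset :: "unit gorder" where
  "unit_poset = \<lparr>carrier = UNIV, eq = (=), le = (\<lambda>_ _. True)\<rparr>"

definition pi0_class :: "('o, 'm) cat \<Rightarrow> 'o \<Rightarrow> 'o set + unit \<Rightarrow> ('o set + unit) set" where
  "pi0_class C x = pushout_class (poset_reflection (slice C x)) (poset_reflection C) unit_poset
     (refl_map C (Dom C)) (\<lambda>_. ())"

definition pi0 :: "('o, 'm) cat \<Rightarrow> 'o \<Rightarrow> ('o set + unit) set pointed_gorder" where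
  "pi0 C x =
    (let W = poset_pushout (poset_reflection (slice C x)) (poset_reflection C) unit_poset
               (refl_map C (Dom C)) (\<lambda>_. ())
     in \<lparr>carrier = carrier W, eq = eq W, le = le W, point = pi0_class C x (Inr ())\<rparr>)"

lemma pushout_unit_preorder:
  assumes "partial_order Q" and f: "f ` carrier P \<subseteq> carrier Q"
  shows "(s, t) \<in> pushout_preorder P Q unit_poset f (\<lambda>_. ()) \<longleftrightarrow>
    s \<in> carrier Q <+> UNIV \<and> t \<in> carrier Q <+> UNIV \<and>
    (case (s, t) of
      (Inl a, Inl b) \<Rightarrow> a \<sqsubseteq>\<^bsub>Q\<^esub> b \<or> ((\<exists>p\<in>carrier P. a \<sqsubseteq>\<^bsub>Q\<^esub> f p) \<and> (\<exists>p\<in>carrier P. f p \<sqsubseteq>\<^bsub>Q\<^esub> b))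
    | (Inl a, Inr _) \<Rightarrow> \<exists>p\<in>carrier P. a \<sqsubseteq>\<^bsub>Q\<^esub> f p
    | (Inr _, Inl b) \<Rightarrow> \<exists>p\<in>carrier P. f p \<sqsubseteq>\<^bsub>Q\<^esub> b
    | (Inr _, Inr _) \<Rightarrow> True)" (is "_ \<longleftrightarrow> ?S s \<and> ?S t \<and> ?E (s, t)")
proof -
  interpret Q: partial_order Q by fact
  let ?r = "pushout_step P Q unit_poset f (\<lambda>_. ())"
  have fQ: "f p \<in> carrier Q" if "p \<in> carrier P" for p using f that by auto
  have step: "(Inl a, Inl b) \<in> ?r\<^sup>*" if "a \<in> carrier Q" "b \<in> carrier Q" "a \<sqsubseteq>\<^bsub>Q\<^esub> b" for a b
    using that by (auto simp: pushout_step_def intro!: r_into_rtrancl)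
  have to: "(Inl a, Inr ()) \<in> ?r\<^sup>*" if "a \<in> carrier Q" "p \<in> carrier P" "a \<sqsubseteq>\<^bsub>Q\<^esub> f p" for a p
  proof -
    have "(Inl (f p), Inr ()) \<in> ?r" using that by (auto simp: pushout_step_def)
    with step[OF that(1) fQ[OF that(2)] that(3)] show ?thesis by (rule rtrancl_into_rtrancl)
  qed
  have out: "(Inr (), Inl b) \<in> ?r\<^sup>*" if "b \<in> carrier Q" "p \<in> carrier P" "f p \<sqsubseteq>\<^bsub>Q\<^esub> b" for b p
  proof -
    have "(Inr (), Inl (f p)) \<in> ?r" using that by (auto simp: pushout_step_def)
    then show ?thesis using step[OF fQ[OF that(2)] that(1) that(3)] by (rule converse_rtrancl_into_rtrancl)
  qed
  have "?S t \<and> ?E (s, t)" if "(s, t) \<in> ?r\<^sup>*" "?S s"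
    using that
  proof (induction rule: rtrancl_induct)
    case base
    then show ?case by (auto split: sum.split)
  next
    case (step y z)
    then have IH: "?S s" "?S y" "?E (s, y)" by auto
    from step.hyps(2) consider
      (le) a b where "y = Inl a" "z = Inl b" "a \<in> carrier Q" "b \<in> carrier Q" "a \<sqsubseteq>\<^bsub>Q\<^esub> b"
      | (unit) "y = Inr ()" "z = Inr ()"
      | (into) p where "y = Inl (f p)" "z = Inr ()" "p \<in> carrier P"
      | (out) p where "y = Inr ()" "z = Inl (f p)" "p \<in> carrier P"
      unfolding pushout_step_def by auto
    then show ?case
    proof cases
      case le
      then show ?thesis using IH fQ
        by (auto split: sum.splits) (meson Q.le_trans)+
    next
      case unit
      then show ?thesis using IH by auto
    next
      case into
      then show ?thesis using IH fQ by (auto split: sum.splits)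
    next
      case out
      moreover have "f p \<sqsubseteq>\<^bsub>Q\<^esub> f p" using out fQ by blast
      ultimately have "\<exists>q\<in>carrier P. f q \<sqsubseteq>\<^bsub>Q\<^esub> f p" using out by blast
      then show ?thesis using IH fQ out by (auto split: sum.splits)
    qed
  qed
  moreover have "(s, t) \<in> ?r\<^sup>*" if S: "?S s" "?S t" and E: "?E (s, t)"
  proof -
    consider (ll) a b where "s = Inl a" "t = Inl b" "a \<in> carrier Q" "b \<in> carrier Q"
      | (lr) a where "s = Inl a" "t = Inr ()" "a \<in> carrier Q"
      | (rl) b where "s = Inr ()" "t = Inl b" "b \<in> carrier Q"
      | (rr) "s = Inr ()" "t = Inr ()"
      using S by auto
    then show ?thesis
    proof cases
      case ll
      then consider "a \<sqsubseteq>\<^bsub>Q\<^esub> b"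
        | p q where "p \<in> carrier P" "q \<in> carrier P" "a \<sqsubseteq>\<^bsub>Q\<^esub> f p" "f q \<sqsubseteq>\<^bsub>Q\<^esub> b"
        using E by auto
      then show ?thesis
        using ll step
        by cases (auto intro: rtrancl_trans[OF to out])
    qed (use E to out in auto)
  qed
  ultimately show ?thesis
    unfolding pushout_preorder_def by (auto simp: unit_poset_def)
qed

lemma carrier_poset_reflection: "carrier (poset_reflection C) = refl_class C ` Obj C"
  by (auto simp: poset_reflection_def preorder_quotient_def quotient_def refl_class_def)

lemma refl_class_le:
  assumes "category C" "y \<in> Obj C" "z \<in> Obj C"
  shows "refl_class C y \<sqsubseteq>\<^bsub>poset_reflection C\<^esub> refl_class C z \<longleftrightarrow> Hom C y z \<noteq> {}"
  using preorder_quotient_le[OF preorder_hom_preorder[OF assms(1)] assms(2,3)] assms(2,3)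
  by (simp add: refl_class_def poset_reflection_def hom_preorder_def)

lemma refl_class_eq:
  assumes "category C" "y \<in> Obj C" "z \<in> Obj C"
  shows "refl_class C y = refl_class C z \<longleftrightarrow> Hom C y z \<noteq> {} \<and> Hom C z y \<noteq> {}"
  using eq_equiv_class_iff[OF equiv_preorder[OF preorder_hom_preorder[OF assms(1)]] assms(2,3)] assms(2,3)
  by (auto simp: refl_class_def hom_preorder_def)

lemma refl_map_class:
  assumes "category C" "category D" "y \<in> Obj C" "\<And>y. y \<in> Obj C \<Longrightarrow> F y \<in> Obj D"
    and F: "\<And>y z. Hom C y z \<noteq> {} \<Longrightarrow> Hom D (F y) (F z) \<noteq> {}"
  shows "refl_map D F (refl_class C y) = refl_class D (F y)"
proof -
  have "y \<in> refl_class C y"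
    using assms(3) category.Ident_Hom[OF assms(1,3)]
    by (auto simp: refl_class_def hom_preorder_def)
  moreover have "refl_class D (F z) = refl_class D (F y)" if "z \<in> refl_class C y" for z
    using that F assms(4) refl_class_eq[OF assms(2)]
    by (auto simp: refl_class_def[of C] hom_preorder_def)
  ultimately show ?thesis unfolding refl_map_def by blast
qed

text \<open>The explicit description of \<open>pi0 C x\<close>.\<close>

theorem pi0_explicit:
  assumes "category C" and x: "x \<in> Obj C"
  defines "cls \<equiv> \<lambda>y. pi0_class C x (Inl (refl_class C y))"
  shows "partial_order (pi0 C x)"
    and "carrier (pi0 C x) = insert (point (pi0 C x)) (cls ` {y \<in> Obj C. Hom C y x = {}})"
    and "\<And>y. \<lbrakk>y \<in> Obj C; Hom C y x \<noteq> {}\<rbrakk> \<Longrightarrow> cls y = point (pi0 C x)"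
    and "\<And>y. y \<in> Obj C \<Longrightarrow> cls y \<sqsubseteq>\<^bsub>pi0 C x\<^esub> point (pi0 C x) \<longleftrightarrow> Hom C y x \<noteq> {}"
    and "\<And>y. y \<in> Obj C \<Longrightarrow> point (pi0 C x) \<sqsubseteq>\<^bsub>pi0 C x\<^esub> cls y \<longleftrightarrow>
           (\<exists>z \<in> Obj C. Hom C z x \<noteq> {} \<and> Hom C z y \<noteq> {})"
    and "\<And>y z. \<lbrakk>y \<in> Obj C; z \<in> Obj C; Hom C y x = {}\<rbrakk> \<Longrightarrow>
           cls y \<sqsubseteq>\<^bsub>pi0 C x\<^esub> cls z \<longleftrightarrow> Hom C y z \<noteq> {}"
proof -
  interpret category C by fact
  let ?P = "poset_reflection (slice C x)" and ?Q = "poset_reflection C"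
  let ?f = "refl_map C (Dom C)" and ?g = "\<lambda>_ :: 'b set. ()"
  let ?W = "poset_pushout ?P ?Q unit_poset ?f ?g"
  interpret W: partial_order ?W by (rule partial_order_poset_pushout)
  have fields: "carrier (pi0 C x) = carrier ?W" "eq (pi0 C x) = eq ?W" "le (pi0 C x) = le ?W"
    "point (pi0 C x) = pi0_class C x (Inr ())"
    by (simp_all add: pi0_def Let_def)
  show PO: "partial_order (pi0 C x)"
    by (unfold_locales; unfold fields W.eq_is_equal)
      (simp_all | rule W.le_antisym, assumption+ | rule W.le_trans, assumption+)+
  interpret PO: partial_order "pi0 C x" by (rule PO)
  have slice_Obj: "k \<in> Obj (slice C x) \<longleftrightarrow> k \<in> Hom C (Dom C k) x" for k
    by (auto simp: slice_def Hom_def)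
  have f: "?f (refl_class (slice C x) k) = refl_class C (Dom C k)" if "k \<in> Obj (slice C x)" for k
    using that by (intro refl_map_class category_slice assms) (auto simp: Hom_slice, auto simp: slice_def)
  have P: "carrier ?P = refl_class (slice C x) ` Obj (slice C x)"
    by (rule carrier_poset_reflection)
  have fP: "?f ` carrier ?P \<subseteq> carrier ?Q"
    by (auto simp: P f carrier_poset_reflection) (auto simp: slice_def)
  have Q: "partial_order ?Q" by (rule partial_order_poset_reflection) fact
  have clsQ: "refl_class C y \<in> carrier ?Q" if "y \<in> Obj C" for y
    using that by (auto simp: carrier_poset_reflection)
  have U: "carrier unit_poset = UNIV" by (simp add: unit_poset_def)
  have le: "pi0_class C x s \<sqsubseteq>\<^bsub>pi0 C x\<^esub> pi0_class C x t \<longleftrightarrow>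
      (s, t) \<in> pushout_preorder ?P ?Q unit_poset ?f ?g"
    if "s \<in> carrier ?Q <+> UNIV" "t \<in> carrier ?Q <+> UNIV" for s t
    unfolding fields pi0_class_def using that U by (intro pushout_class_le) auto
  have car: "carrier (pi0 C x) = pi0_class C x ` (carrier ?Q <+> UNIV)"
    unfolding fields pi0_class_def carrier_poset_pushout U by simp
  have below: "(\<exists>p\<in>carrier ?P. refl_class C y \<sqsubseteq>\<^bsub>?Q\<^esub> ?f p) \<longleftrightarrow> Hom C y x \<noteq> {}" if y: "y \<in> Obj C" for y
  proof
    assume "\<exists>p\<in>carrier ?P. refl_class C y \<sqsubseteq>\<^bsub>?Q\<^esub> ?f p"
    then obtain k where k: "k \<in> Obj (slice C x)" "refl_class C y \<sqsubseteq>\<^bsub>?Q\<^esub> refl_class C (Dom C k)"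
      by (auto simp: P f)
    then have "Hom C y (Dom C k) \<noteq> {}"
      using refl_class_le[OF assms(1) y] Hom_objs[OF assms(1)] slice_Obj by blast
    then show "Hom C y x \<noteq> {}" using k(1) Comp_Hom slice_Obj by blast
  next
    assume "Hom C y x \<noteq> {}"
    then obtain k where k: "k \<in> Hom C y x" by blast
    then have "k \<in> Obj (slice C x)" "Dom C k = y" by (auto simp: slice_Obj Hom_def)
    then show "\<exists>p\<in>carrier ?P. refl_class C y \<sqsubseteq>\<^bsub>?Q\<^esub> ?f p"
      using refl_class_le[OF assms(1) y y] Ident_Hom[OF y] by (auto simp: P f)
  qed
  have above: "(\<exists>p\<in>carrier ?P. ?f p \<sqsubseteq>\<^bsub>?Q\<^esub> refl_class C y) \<longleftrightarrow>
      (\<exists>z \<in> Obj C. Hom C z x \<noteq> {} \<and> Hom C z y \<noteq> {})" if y: "y \<in> Obj C" for y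
  proof
    assume "\<exists>p\<in>carrier ?P. ?f p \<sqsubseteq>\<^bsub>?Q\<^esub> refl_class C y"
    then obtain k where k: "k \<in> Obj (slice C x)" "refl_class C (Dom C k) \<sqsubseteq>\<^bsub>?Q\<^esub> refl_class C y"
      by (auto simp: P f)
    then have "Dom C k \<in> Obj C" "k \<in> Hom C (Dom C k) x"
      using Hom_objs[OF assms(1)] slice_Obj by blast+
    then show "\<exists>z \<in> Obj C. Hom C z x \<noteq> {} \<and> Hom C z y \<noteq> {}"
      using k(2) refl_class_le[OF assms(1) _ y] by blast
  next
    assume "\<exists>z \<in> Obj C. Hom C z x \<noteq> {} \<and> Hom C z y \<noteq> {}"
    then obtain z k where z: "z \<in> Obj C" "k \<in> Hom C z x" "Hom C z y \<noteq> {}" by blast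
    then have "k \<in> Obj (slice C x)" "Dom C k = z" by (auto simp: slice_Obj Hom_def)
    then show "\<exists>p\<in>carrier ?P. ?f p \<sqsubseteq>\<^bsub>?Q\<^esub> refl_class C y"
      using refl_class_le[OF assms(1) z(1) y] z(3) by (auto simp: P f)
  qed
  note pre = pushout_unit_preorder[OF Q fP]
  have A: "Inl (refl_class C y) \<in> carrier ?Q <+> (UNIV :: unit set)" if "y \<in> Obj C" for y
    using clsQ[OF that] by blast
  have B: "Inr () \<in> carrier ?Q <+> (UNIV :: unit set)" by blast
  show le_pt: "cls y \<sqsubseteq>\<^bsub>pi0 C x\<^esub> point (pi0 C x) \<longleftrightarrow> Hom C y x \<noteq> {}" if y: "y \<in> Obj C" for y
    unfolding cls_def fields(4) le[OF A[OF y] B] pre using below[OF y] A[OF y] B by simp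
  show pt_le: "point (pi0 C x) \<sqsubseteq>\<^bsub>pi0 C x\<^esub> cls y \<longleftrightarrow>
      (\<exists>z \<in> Obj C. Hom C z x \<noteq> {} \<and> Hom C z y \<noteq> {})" if y: "y \<in> Obj C" for y
    unfolding cls_def fields(4) le[OF B A[OF y]] pre using above[OF y] A[OF y] B by simp
  show "cls y \<sqsubseteq>\<^bsub>pi0 C x\<^esub> cls z \<longleftrightarrow> Hom C y z \<noteq> {}"
    if y: "y \<in> Obj C" and z: "z \<in> Obj C" and n: "Hom C y x = {}" for y z
    unfolding cls_def le[OF A[OF y] A[OF z]] pre
    using below[OF y] n A[OF y] A[OF z] refl_class_le[OF assms(1) y z] by simp
  have cls_car: "cls y \<in> carrier (pi0 C x)" if "y \<in> Obj C" for y
    unfolding car cls_def using A[OF that] by (rule imageI)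
  have pt_car: "point (pi0 C x) \<in> carrier (pi0 C x)"
    unfolding car fields(4) using B by (rule imageI)
  show eq_pt: "cls y = point (pi0 C x)" if y: "y \<in> Obj C" and ne: "Hom C y x \<noteq> {}" for y
  proof (rule PO.le_antisym)
    show "cls y \<sqsubseteq>\<^bsub>pi0 C x\<^esub> point (pi0 C x)" using le_pt[OF y] ne by simp
    show "point (pi0 C x) \<sqsubseteq>\<^bsub>pi0 C x\<^esub> cls y" using pt_le[OF y] ne y Ident_Hom[OF y] by blast
  qed (use cls_car[OF y] pt_car in auto)
  show "carrier (pi0 C x) = insert (point (pi0 C x)) (cls ` {y \<in> Obj C. Hom C y x = {}})"
  proof
    show "carrier (pi0 C x) \<subseteq> insert (point (pi0 C x)) (cls ` {y \<in> Obj C. Hom C y x = {}})"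
    proof
      fix X assume "X \<in> carrier (pi0 C x)"
      then consider y where "y \<in> Obj C" "X = cls y" | "X = point (pi0 C x)"
        unfolding car carrier_poset_reflection cls_def fields(4) by auto
      then show "X \<in> insert (point (pi0 C x)) (cls ` {y \<in> Obj C. Hom C y x = {}})"
        using eq_pt by cases blast+
    qed
  qed (use pt_car cls_car in auto)
qed

definition pi1 :: "('o, 'm) cat \<Rightarrow> 'o \<Rightarrow> (('m \<times> 'm) set + unit) set pointed_gorder" where
  "pi1 C x = pi0 (Par C x) (Ident C x, Ident C x)"

definition discrete_poset :: "('a, 'b) gorder_scheme \<Rightarrow> bool" where
  "discrete_poset P \<longleftrightarrow>
    partial_order P \<and> (\<forall>a\<in>carrier P. \<forall>b\<in>carrier P. a \<sqsubseteq>\<^bsub>P\<^esub> b \<longrightarrow> a = b)"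

end

theory Submission
  imports Defs
begin

text \<open>
  In a groupoid, a parallel pair \<open>(f\<^sub>0, f\<^sub>1)\<close> over \<open>x\<close> maps to \<open>(id\<^sub>x, a)\<close> along \<open>f\<^sub>0\<close>, where
  \<open>a = f\<^sub>0\<^sup>-\<^sup>1 ; f\<^sub>1\<close>, and a morphism from \<open>(id\<^sub>x, a)\<close> to \<open>(id\<^sub>x, b)\<close> is forced to be the identity,
  so that \<open>a = b\<close>. Morphisms of parallel pairs are invertible. Hence \<open>Par(G/x)\<close> is a disjoint union
  of connected components indexed by \<open>Hom(x, x)\<close>, and forming \<open>\<pi>\<^sub>0\<close> only singles out the component
  of \<open>(id\<^sub>x, id\<^sub>x)\<close>.
\<close>

context
  fixes C :: "('o, 'm) cat" and x :: 'o
  assumes C: "category C" and x: "x \<in> Obj C"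
    and hom_sym: "\<And>y z. Hom C y z \<noteq> {} \<Longrightarrow> Hom C z y \<noteq> {}"
begin

text \<open>The identity of \<open>x\<close> places \<open>x\<close> itself among the objects
  mapping to \<open>x\<close>, so the point is the class of \<open>x\<close> and every element of
  the quotient is represented by an object.\<close>

lemma pi0_carrier_sym:
  "carrier (pi0 C x) = (\<lambda>y. pi0_class C x (Inl (refl_class C y))) ` Obj C"
proof -
  have "point (pi0 C x) = pi0_class C x (Inl (refl_class C x))"
    using pi0_explicit(3)[OF C x x] category.Ident_Hom[OF C x] by auto
  then have "point (pi0 C x) \<in> (\<lambda>y. pi0_class C x (Inl (refl_class C y))) ` Obj C"
    using x by blast
  then show ?thesis
    unfolding pi0_explicit(2)[OF C x] using pi0_explicit(3)[OF C x] by (blast intro: rev_image_eqI)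
qed

text \<open>Collapsing to the point does not disturb the order here: \<open>hom_sym\<close> makes
  the existence of a morphism an equivalence relation, so only objects already equivalent to
  \<open>x\<close> are collapsed.\<close>

lemma pi0_class_le_sym:
  assumes y: "y \<in> Obj C" and z: "z \<in> Obj C"
  shows "pi0_class C x (Inl (refl_class C y)) \<sqsubseteq>\<^bsub>pi0 C x\<^esub> pi0_class C x (Inl (refl_class C z))
    \<longleftrightarrow> Hom C y z \<noteq> {}"
proof (cases "Hom C y x = {}")
  case True
  then show ?thesis using pi0_explicit(6)[OF C x y z] by simp
next
  case False
  have trans: "Hom C u w \<noteq> {}" if "Hom C u v \<noteq> {}" "Hom C v w \<noteq> {}" for u v w
    using that category.Comp_Hom[OF C] by blast
  show ?thesis
    \<comment> \<open>The class of \<open>y\<close> is now the point, which lies below the class of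
      \<open>z\<close> iff there is a span from \<open>x\<close> to \<open>z\<close>. Reversing the
      left leg of such a span gives \<open>y\<close> to \<open>x\<close> to \<open>z\<close>;
      conversely, \<open>y\<close> itself is the apex of a span.\<close>
    using pi0_explicit(3)[OF C x y False] pi0_explicit(5)[OF C x z] False y hom_sym trans by metis
qed

text \<open>By \<open>hom_sym\<close> the order is symmetric, and antisymmetry turns it into
  equality.\<close>

lemma discrete_pi0_sym: "discrete_poset (pi0 C x)"
  unfolding discrete_poset_def
proof (intro conjI ballI impI)
  interpret partial_order "pi0 C x" by (rule pi0_explicit(1)[OF C x])
  show "partial_order (pi0 C x)" by unfold_locales
  fix a b assume ab: "a \<in> carrier (pi0 C x)" "b \<in> carrier (pi0 C x)" "a \<sqsubseteq>\<^bsub>pi0 C x\<^esub> b"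
  then obtain y z where yz: "y \<in> Obj C" "z \<in> Obj C"
    "a = pi0_class C x (Inl (refl_class C y))" "b = pi0_class C x (Inl (refl_class C z))"
    unfolding pi0_carrier_sym by blast
  then have "b \<sqsubseteq>\<^bsub>pi0 C x\<^esub> a" using ab(3) hom_sym[of y z] by (simp add: pi0_class_le_sym)
  with ab show "a = b" by (simp add: le_antisym)
qed

lemma pi0_class_eq_sym:
  assumes "y \<in> Obj C" "z \<in> Obj C"
  shows "pi0_class C x (Inl (refl_class C y)) = pi0_class C x (Inl (refl_class C z))
    \<longleftrightarrow> Hom C y z \<noteq> {}"
proof
  assume "pi0_class C x (Inl (refl_class C y)) = pi0_class C x (Inl (refl_class C z))"
  then show "Hom C y z \<noteq> {}"
    using pi0_class_le_sym[OF assms] pi0_class_le_sym[OF assms(2,2)] category.Ident_Hom[OF C assms(2)]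
    by auto
next
  assume "Hom C y z \<noteq> {}"
  then show "pi0_class C x (Inl (refl_class C y)) = pi0_class C x (Inl (refl_class C z))"
    using discrete_pi0_sym pi0_class_le_sym[OF assms] assms
    by (auto simp: discrete_poset_def pi0_carrier_sym)
qed

end

context groupoid
begin

lemma Par_Obj: "(f0, f1) \<in> Obj (Par G x) \<longleftrightarrow> f0 \<in> Hom G (Dom G f0) x \<and> f1 \<in> Hom G (Dom G f0) x"
  by (auto simp: Par_def par_obj_def Hom_def)

text \<open>The inverse in \<open>G\<close> of the underlying arrow is again compatible with both
  components of the pairs. This supplies \<open>hom_sym\<close> for \<open>Par G x\<close>.\<close>

lemma Par_Hom_sym:
  assumes "Hom (Par G x) f g \<noteq> {}"
  shows "Hom (Par G x) g f \<noteq> {}"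
proof -
  from assms obtain h where objs: "f \<in> Obj (Par G x)" "g \<in> Obj (Par G x)"
    and h: "h \<in> Hom G (Dom G (fst f)) (Dom G (fst g))"
    and eqs: "fst f = h \<Zcomp> fst g" "snd f = h \<Zcomp> snd g"
    unfolding Hom_Par by blast
  obtain k where k: "k \<in> Hom G (Dom G (fst g)) (Dom G (fst f))" "k \<Zcomp> h = Ident G (Dom G (fst g))"
    using Inverse_ex[OF h] by blast
  have g: "fst g \<in> Hom G (Dom G (fst g)) x" "snd g \<in> Hom G (Dom G (fst g)) x"
    using objs(2) Par_Obj[of "fst g" "snd g"] by simp_all
  have "fst g = k \<Zcomp> fst f" "snd g = k \<Zcomp> snd f"
    unfolding eqs using k g h by (simp_all flip: Comp_assoc add: Ident_left)
  then show ?thesis unfolding Hom_Par using objs k by blast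
qed

lemma Par_connected_to_loop:
  assumes "f \<in> Obj (Par G x)"
  obtains a where "a \<in> Hom G x x" "Hom (Par G x) f (Ident G x, a) \<noteq> {}"
proof -
  obtain f0 f1 y where f: "f = (f0, f1)" and y: "y = Dom G f0"
    and f0: "f0 \<in> Hom G y x" and f1: "f1 \<in> Hom G y x"
    using assms Par_Obj by (cases f) auto
  \<comment> \<open>Here \<open>k\<close> is the inverse of \<open>f0\<close>, and
    \<open>k \<Zcomp> f1\<close> will be the loop.\<close>
  obtain k where k: "k \<in> Hom G x y" "f0 \<Zcomp> k = Ident G y"
    using Inverse_ex[OF f0] by blast
  have x: "x \<in> Obj G" using f0 by (auto simp: Hom_def)
  have id: "Dom G (Ident G x) = x" "Ident G x \<in> Hom G x x"
    using Ident_Hom[OF x] by (auto simp: Hom_def)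
  have a: "k \<Zcomp> f1 \<in> Hom G x x" using k f1 by (blast intro: Comp_Hom)
  have "f1 = f0 \<Zcomp> (k \<Zcomp> f1)" using k f0 f1 by (simp flip: Comp_assoc add: Ident_left)
  moreover have "f0 = f0 \<Zcomp> Ident G x" using f0 by (simp add: Ident_right)
  moreover have "(Ident G x, k \<Zcomp> f1) \<in> Obj (Par G x)" using id a by (simp add: Par_Obj)
  moreover have "f0 \<in> Hom G (Dom G f0) (Dom G (Ident G x))" using f0 y id(1) by simp
  ultimately have "(f, f0, Ident G x, k \<Zcomp> f1) \<in> Hom (Par G x) f (Ident G x, k \<Zcomp> f1)"
    unfolding Hom_Par f mem_Collect_eq fst_conv snd_conv using assms[unfolded f] by blast
  with a that show thesis by blast
qed

lemma Par_Hom_loops: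
  assumes "a \<in> Hom G x x" "b \<in> Hom G x x"
  shows "Hom (Par G x) (Ident G x, a) (Ident G x, b) \<noteq> {} \<longleftrightarrow> a = b"
proof -
  have x: "x \<in> Obj G" using assms by (auto simp: Hom_def)
  have id: "Dom G (Ident G x) = x" "Ident G x \<in> Hom G x x"
    using Ident_Hom[OF x] by (auto simp: Hom_def)
  have "Hom (Par G x) (Ident G x, a) (Ident G x, b) \<noteq> {} \<longleftrightarrow>
      (\<exists>h \<in> Hom G x x. Ident G x = h \<Zcomp> Ident G x \<and> a = h \<Zcomp> b)"
    using assms id by (auto simp: Hom_Par Par_Obj)
  also have "\<dots> \<longleftrightarrow> a = b"
    \<comment> \<open>The first equation forces \<open>h\<close> to be the identity, and the second
      then reads \<open>a = b\<close>.\<close>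
    using id assms Ident_left[OF assms(2)] Ident_left[OF id(2)] Ident_right by metis
  finally show ?thesis .
qed

end

theorem proposition9:
  fixes G :: "('o, 'm) cat" and x :: 'o
  assumes "groupoid G" and "x \<in> Obj G"
  shows "discrete_poset (pi1 G x) \<and>
    (\<exists>\<phi>. bij_betw \<phi> (carrier (pi1 G x)) (carrier (fundamental_group G x)) \<and>
         \<phi> (point (pi1 G x)) = \<one>\<^bsub>fundamental_group G x\<^esub>)"
proof -
  interpret groupoid G by fact
  let ?P = "Par G x" and ?e = "(Ident G x, Ident G x)"
  define c where "c p = pi0_class ?P ?e (Inl (refl_class ?P p))" for p
  \<comment> \<open>The bijection is built from loops to classes, where no representative has to be
    chosen; the required map is its inverse.\<close>
  define \<psi> where "\<psi> a = c (Ident G x, a)" for a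
  have P: "category ?P" by (intro category_Par) unfold_locales
  have id: "Dom G (Ident G x) = x" "Ident G x \<in> Hom G x x"
    using Ident_Hom[OF assms(2)] by (auto simp: Hom_def)
  have loop: "(Ident G x, a) \<in> Obj ?P" if "a \<in> Hom G x x" for a
    using that id by (simp add: Par_Obj)
  have e: "?e \<in> Obj ?P" using loop id(2) by blast
  have c_eq: "c p = c q \<longleftrightarrow> Hom ?P p q \<noteq> {}" if "p \<in> Obj ?P" "q \<in> Obj ?P" for p q
    unfolding c_def by (rule pi0_class_eq_sym[OF P e Par_Hom_sym that])
  have carrier: "carrier (pi1 G x) = c ` Obj ?P"
    unfolding pi1_def c_def by (rule pi0_carrier_sym[OF P e Par_Hom_sym])
  have inj: "inj_on \<psi> (Hom G x x)"
    by (rule inj_onI) (simp only: \<psi>_def c_eq loop Par_Hom_loops)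
  have surj: "\<psi> ` Hom G x x = carrier (pi1 G x)"
  proof -
    have "c p \<in> \<psi> ` Hom G x x" if p: "p \<in> Obj ?P" for p
    proof -
      obtain a where a: "a \<in> Hom G x x" "Hom ?P p (Ident G x, a) \<noteq> {}"
        using Par_connected_to_loop[OF p] .
      then have "c p = \<psi> a" unfolding \<psi>_def by (simp add: c_eq[OF p loop])
      with a show ?thesis by blast
    qed
    then show ?thesis unfolding carrier using loop by (auto simp: \<psi>_def)
  qed
  \<comment> \<open>The pair \<open>?e\<close> has a morphism to itself, so its class is the
    point.\<close>
  have pt: "\<psi> (Ident G x) = point (pi1 G x)"
    unfolding pi1_def \<psi>_def c_def
    by (rule pi0_explicit(3)[OF P e e]) (simp add: Par_Hom_loops id(2))
  let ?\<phi> = "the_inv_into (Hom G x x) \<psi>"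
  have "bij_betw ?\<phi> (carrier (pi1 G x)) (Hom G x x)"
    using inj surj by (intro bij_betw_the_inv_into) (simp add: bij_betw_def)
  moreover have "?\<phi> (point (pi1 G x)) = Ident G x"
    unfolding pt[symmetric] by (rule the_inv_into_f_f[OF inj id(2)])
  moreover have "discrete_poset (pi1 G x)"
    unfolding pi1_def by (rule discrete_pi0_sym[OF P e Par_Hom_sym])
  moreover have "carrier (fundamental_group G x) = Hom G x x" "\<one>\<^bsub>fundamental_group G x\<^esub> = Ident G x"
    by (simp_all add: fundamental_group_def)
  ultimately show ?thesis by (intro conjI exI[of _ ?\<phi>]) simp_all
qed

end
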